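(* Let $\lambda\in\mathbb{C}$ with $\lambda\neq 1$, let $r,k\in\mathbb{Z}$ and $n\ge 0$. Then \[ T_{n}^{(r,k)}(x|\lambda)=\sum_{m=0}^{n}\left\{ \sum_{l=0}^{n-m} \binom{n}{l+m} S_{2}(l+m,m)T_{n-m-l}^{(r,k)}(\lambda) \right\}(x)_{m}. \]
   Context: For $k\in\mathbb{Z}$, $Li_k(x)=\sum_{n\ge1}x^n/n^k$. For $r,k\in\mathbb{Z}$ the polynomials $T_n^{(r,k)}(x|\lambda)$ are defined by $\left(\frac{1-\lambda}{e^t-\lambda}\right)^r\frac{Li_{k}(1-e^{-t})}{1-e^{-t}}e^{xt}=\sum_{n\ge0}T_n^{(r,k)}(x|\lambda)\frac{t^n}{n!}$ (as formal power series in $t$), and $T_n^{(r,k)}(\lambda)=T_n^{(r,k)}(0|\lambda)$. $(x)_m=x(x-1)\cdots(x-m+1)$ is the falling factorial, and $S_2(l,m)$ denotes the Stirling numbers of the second kind, $(e^t-1)^m=m!\sum_{l\ge m}S_2(l,m)\frac{t^l}{l!}$. *)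

theory Defs
  imports
    Complex_Main
    "HOL-Computational_Algebra.Formal_Power_Series"
    "HOL-Computational_Algebra.Polynomial"
    "HOL-Combinatorics.Stirling"
begin

definition Li_fps :: "int \<Rightarrow> complex fps" where
  "Li_fps k = Abs_fps (\<lambda>n. if n = 0 then 0 else 1 / of_nat n powi k)"

(* Both outer series have to be read with some care. The base of the r-th power is a unit
   with constant term 1 when lam is not 1, so that powi also makes sense for negative r.
   The series 1 - e^(-t) has no constant term; the division by it is exact,
   see T_base_unit and Li_fps_quotient below. *)
definition T_base :: "int \<Rightarrow> int \<Rightarrow> complex \<Rightarrow> complex fps" where
  "T_base r k lam =
     (fps_const (1 - lam) / (fps_exp 1 - fps_const lam)) powi r *
     ((Li_fps k oo (1 - fps_exp (-1))) / (1 - fps_exp (-1)))"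

(* e^(xt) as a power series in t over the polynomial ring in x *)
definition exp_xt :: "complex poly fps" where
  "exp_xt = Abs_fps (\<lambda>n. monom (1 / fact n) n)"

(* The generating function is a power series in t over the polynomial ring in x;
   T_base is embedded there coefficientwise. *)
definition T_poly :: "nat \<Rightarrow> int \<Rightarrow> int \<Rightarrow> complex \<Rightarrow> complex poly" where
  "T_poly n r k lam =
     smult (fact n) (fps_nth (Abs_fps (\<lambda>i. [:fps_nth (T_base r k lam) i:]) * exp_xt) n)"

definition T_num :: "nat \<Rightarrow> int \<Rightarrow> int \<Rightarrow> complex \<Rightarrow> complex" where
  "T_num n r k lam = poly (T_poly n r k lam) 0"

definition falling_fact :: "'a::comm_ring_1 \<Rightarrow> nat \<Rightarrow> 'a" where
  "falling_fact x m = (\<Prod>i<m. x - of_nat i)"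

lemma Li_fps_quotient:
  "((Li_fps k oo (1 - fps_exp (-1))) / (1 - fps_exp (-1))) * (1 - fps_exp (-1))
     = Li_fps k oo (1 - fps_exp (-1))"
proof -
  define u :: "complex fps" where "u = 1 - fps_exp (-1)"
  have u: "fps_nth u 0 = 0" "fps_nth u 1 \<noteq> 0" by (simp_all add: u_def)
  hence "subdegree u = 1" "u \<noteq> 0" by (auto intro: subdegreeI)
  moreover have "fps_nth (Li_fps k oo u) 0 = 0"
    by (simp add: Li_fps_def)
  ultimately have "u dvd (Li_fps k oo u)"
    by (cases "Li_fps k oo u = 0") (auto simp: fps_dvd_iff intro!: subdegree_geI)
  hence "(1 - fps_exp (-1)) dvd (Li_fps k oo (1 - fps_exp (-1)))"
    by (simp add: u_def)
  thus ?thesis by (rule dvd_div_mult_self)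
qed

lemma T_base_unit:
  assumes "lam \<noteq> (1 :: complex)"
  shows "(fps_const (1 - lam) / (fps_exp 1 - fps_const lam)) * (fps_exp 1 - fps_const lam)
           = fps_const (1 - lam)"
    and "fps_nth (fps_const (1 - lam) / (fps_exp 1 - fps_const lam)) 0 = 1"
proof -
  have unit: "fps_nth (fps_exp 1 - fps_const lam) 0 \<noteq> 0" using assms by simp
  show "(fps_const (1 - lam) / (fps_exp 1 - fps_const lam)) * (fps_exp 1 - fps_const lam)
          = fps_const (1 - lam)"
    using unit by (simp add: fps_divide_unit mult.assoc inverse_mult_eq_1)
  show "fps_nth (fps_const (1 - lam) / (fps_exp 1 - fps_const lam)) 0 = 1"
    using unit by (simp add: fps_divide_unit)
qed

lemma T_poly_egf:
  "Abs_fps (\<lambda>n. poly (T_poly n r k lam) x / fact n) = T_base r k lam * fps_exp x"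
  by (rule fps_ext)
     (simp add: T_poly_def exp_xt_def fps_mult_nth poly_sum poly_monom)

lemma exp_minus_one_power_Stirling:
  "(fps_exp 1 - 1) ^ m = Abs_fps (\<lambda>l. fact m * of_nat (Stirling l m) / fact l :: complex)"
proof (rule fps_ext)
  fix l
  define E :: "complex fps" where "E = fps_exp 1 - 1"
  have "fps_nth (E ^ m) l = fact m * of_nat (Stirling l m) / fact l"
  proof (induction l m rule: Stirling.induct)
    case 1
    show ?case by simp
  next
    case (2 m)
    show ?case by (simp add: E_def)
  next
    case (3 l)
    show ?case by simp
  next
    case (4 l m)
    have "fps_deriv E = E + 1" by (simp add: E_def)
    hence "fps_deriv (E ^ Suc m) = of_nat (Suc m) * (E ^ Suc m + E ^ m)"
      by (subst fps_deriv_power) (simp add: algebra_simps flip: fps_of_nat)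
    hence "of_nat (Suc l) * fps_nth (E ^ Suc m) (Suc l) =
             of_nat (Suc m) * (fps_nth (E ^ Suc m) l + fps_nth (E ^ m) l)"
      by (metis Suc_eq_plus1 fps_add_nth fps_deriv_nth fps_mult_of_nat_nth(1))
    hence "fps_nth (E ^ Suc m) (Suc l) =
             of_nat (Suc m) * (fps_nth (E ^ Suc m) l + fps_nth (E ^ m) l) / of_nat (Suc l)"
      by (metis nonzero_mult_div_cancel_left of_nat_neq_0)
    also have "\<dots> = fact (Suc m) * of_nat (Stirling (Suc l) (Suc m)) / fact (Suc l)"
      unfolding 4 by (simp add: divide_simps) (simp add: algebra_simps)
    finally show ?case .
  qed
  thus "fps_nth ((fps_exp 1 - 1) ^ m) l =
      fps_nth (Abs_fps (\<lambda>l. fact m * of_nat (Stirling l m) / fact l :: complex)) l"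
    by (simp add: E_def)
qed

end

theory Submission
  imports Defs
begin

text \<open>
  Comparing coefficients in the generating function gives the Appell expansion
  \<open>T\<^sub>n(x) = \<Sum>\<^sub>j (n choose j) T\<^sub>n\<^sub>-\<^sub>j x\<^sup>j\<close>; substituting \<open>x\<^sup>j = \<Sum>\<^sub>m S\<^sub>2(j,m) (x)\<^sub>m\<close> and exchanging
  the two sums, with \<open>j = l + m\<close>, gives the theorem.
\<close>

text \<open>Induction on \<open>n\<close>: the rule x (x)_m = m (x)_m + (x)_{m+1} matches the
  recurrence of the Stirling numbers. The ring is general so that \<open>x\<close> can later be the
  polynomial \<open>[:0, 1:]\<close>.\<close>

lemma power_eq_sum_Stirling_falling_fact:
  fixes x :: "'a :: comm_ring_1"
  shows "x ^ n = (\<Sum>m\<le>n. of_nat (Stirling n m) * falling_fact x m)"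
proof (induction n)
  case 0
  show ?case by (simp add: falling_fact_def)
next
  case (Suc n)
  let ?S = "\<lambda>m. of_nat (Stirling n m) :: 'a" and ?f = "falling_fact x"
  have mult_f: "x * ?f m = of_nat m * ?f m + ?f (Suc m)" for m
    by (simp add: falling_fact_def algebra_simps)
  \<comment> \<open>The new top term vanishes as \<open>Stirling n (Suc n) = 0\<close>; the term at
    0, split off next, vanishes by its factor \<open>m\<close>.\<close>
  have "(\<Sum>m\<le>n. of_nat m * ?S m * ?f m) = (\<Sum>m\<le>Suc n. of_nat m * ?S m * ?f m)"
    by simp
  also have "\<dots> = (\<Sum>m\<le>n. of_nat (Suc m) * ?S (Suc m) * ?f (Suc m))"
    by (subst sum.atMost_Suc_shift) simp
  finally have shift: "(\<Sum>m\<le>n. of_nat m * ?S m * ?f m) = \<dots>" .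
  have "x ^ Suc n = (\<Sum>m\<le>n. ?S m * (x * ?f m))"
    by (simp add: Suc sum_distrib_left mult.left_commute)
  also have "\<dots> = (\<Sum>m\<le>n. of_nat m * ?S m * ?f m) + (\<Sum>m\<le>n. ?S m * ?f (Suc m))"
    by (simp add: mult_f sum.distrib algebra_simps)
  also have "\<dots> = (\<Sum>m\<le>n. of_nat (Stirling (Suc n) (Suc m)) * ?f (Suc m))"
    unfolding shift by (simp add: sum.distrib algebra_simps)
  also have "\<dots> = (\<Sum>m\<le>Suc n. of_nat (Stirling (Suc n) m) * ?f m)"
    by (subst sum.atMost_Suc_shift) simp
  finally show ?case .
qed

lemma smult_sum_right: "smult c (\<Sum>i\<in>A. f i) = (\<Sum>i\<in>A. smult c (f i))"
  by (induction A rule: infinite_finite_induct) (simp_all add: smult_add_right)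

lemma T_poly_eq_sum_T_base:
  "T_poly n r k lam = (\<Sum>j\<le>n. monom (fact n * fps_nth (T_base r k lam) (n - j) / fact j) j)"
proof -
  have "T_poly n r k lam =
      (\<Sum>i\<le>n. monom (fact n * fps_nth (T_base r k lam) i / fact (n - i)) (n - i))"
    by (simp add: T_poly_def exp_xt_def fps_mult_nth smult_sum_right smult_monom atLeast0AtMost)
  also have "\<dots> = (\<Sum>j\<le>n. monom (fact n * fps_nth (T_base r k lam) (n - j) / fact j) j)"
    by (rule sum.reindex_bij_witness[of _ "\<lambda>j. n - j" "\<lambda>j. n - j"]) auto
  finally show ?thesis .
qed

text \<open>At x = 0 only the monomial with \<open>j = 0\<close> survives.\<close>

lemma T_num_eq: "T_num n r k lam = fact n * fps_nth (T_base r k lam) n"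
  by (simp add: T_num_def T_poly_eq_sum_T_base poly_sum poly_monom power_0_left
      if_distrib sum.delta cong: if_cong)

text \<open>Here n!/j! is the binomial coefficient times (n-j)!, and \<open>T_num_eq\<close> absorbs
  the latter factor.\<close>

lemma T_poly_Appell:
  "T_poly n r k lam = (\<Sum>j\<le>n. smult (of_nat (n choose j) * T_num (n - j) r k lam) ([:0, 1:] ^ j))"
  unfolding T_poly_eq_sum_T_base
  by (intro sum.cong refl) (simp add: T_num_eq monom_altdef binomial_fact)

theorem theorem9:
  fixes lam :: complex and r k :: int and n :: nat
  assumes "lam \<noteq> 1"
  shows "T_poly n r k lam =
    (\<Sum>m = 0..n.
       smult (\<Sum>l = 0..n - m. of_nat (n choose (l + m)) * of_nat (Stirling (l + m) m)
                * T_num (n - m - l) r k lam)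
         (falling_fact [:0, 1:] m))"
proof -
  define c where
    "c j m = of_nat (n choose j) * of_nat (Stirling j m) * T_num (n - j) r k lam" for j m
  let ?f = "falling_fact [:0, 1 :: complex:]"
  have "T_poly n r k lam = (\<Sum>j\<le>n. \<Sum>m\<le>j. smult (c j m) (?f m))"
    unfolding T_poly_Appell power_eq_sum_Stirling_falling_fact
    by (simp add: c_def smult_sum_right of_nat_poly mult_ac)
  also have "\<dots> = (\<Sum>(j, m)\<in>Sigma {..n} (\<lambda>j. {..j}). smult (c j m) (?f m))"
    by (simp add: sum.Sigma)
  \<comment> \<open>The truncated difference \<open>j - m\<close> is exact because
    \<open>m \<le> j\<close> on the triangle, so the two witness maps are mutually inverse.\<close>
  also have "\<dots> = (\<Sum>(m, l)\<in>Sigma {0..n} (\<lambda>m. {0..n - m}). smult (c (l + m) m) (?f m))"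
    by (rule sum.reindex_bij_witness
        [of _ "\<lambda>(m, l). (l + m, m)" "\<lambda>(j, m). (m, j - m)"]) auto
  also have "\<dots> = (\<Sum>m = 0..n. smult (\<Sum>l = 0..n - m. c (l + m) m) (?f m))"
    by (simp add: sum.Sigma smult_sum)
  finally show ?thesis
    by (simp add: c_def add.commute)
qed

end
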